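(* Let $R$ be a finite local ring with $|R|=q^n$ for some $n \geq 2$ and $R/J=GF(q)$. Then: (i) for $x \in R$, we have $x \in R^*$ if and only if $\mathrm{Prob}_x(R)=\frac{q-1}{q^{n+1}}$; (ii) if $0 \neq x \in J$, then $$\frac{(q-1)(q^{n-2}+1)}{q^{2n-1}} \leq \mathrm{Prob}_x(R) \leq \frac{q^{n-1}+q-2}{q^{n+1}};$$ (iii) $$\frac{3q^{n-1}-q^{n-2}-1}{q^{2n-1}} \leq \mathrm{Prob}_0(R) \leq \frac{q^{n-1}+2q-2}{q^{n+1}}.$$
   Context: Rings are associative with unity $1$, not necessarily commutative. $J=J(R)$ is the Jacobson radical of $R$, $R^*$ is the group of units of $R$, and $GF(q)$ is the finite field with $q$ elements ($R/J=GF(q)$ means isomorphic as rings). For a finite ring $R$ and $x \in R$, the multiplication probability is $\mathrm{Prob}_x(R)=\frac{|\{(a,b) \in R^2 : ab=x\}|}{|R|^2}$. *)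

theory Defs
  imports Complex_Main "HOL-Algebra.Algebra"
begin

text \<open>
  The locale \<open>ring\<close> does not assume commutativity, but HOL-Algebra only knows two-sided
  ideals.  The Jacobson radical and locality of a noncommutative ring are defined
  through left ideals.
\<close>

definition left_ideal :: "'a set \<Rightarrow> ('a, 'm) ring_scheme \<Rightarrow> bool" where
  "left_ideal I R \<longleftrightarrow>
     additive_subgroup I R \<and> (\<forall>r\<in>carrier R. \<forall>a\<in>I. r \<otimes>\<^bsub>R\<^esub> a \<in> I)"

definition maximal_left_ideal :: "'a set \<Rightarrow> ('a, 'm) ring_scheme \<Rightarrow> bool" where
  "maximal_left_ideal M R \<longleftrightarrow>
     left_ideal M R \<and> M \<noteq> carrier R \<and>
     (\<forall>I. left_ideal I R \<and> M \<subseteq> I \<longrightarrow> I = M \<or> I = carrier R)"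

text \<open>Intersecting with the carrier makes the radical of the zero ring the whole ring.\<close>

definition jacobson_radical :: "('a, 'm) ring_scheme \<Rightarrow> 'a set" where
  "jacobson_radical R = carrier R \<inter> \<Inter> {M. maximal_left_ideal M R}"

definition local_ring :: "('a, 'm) ring_scheme \<Rightarrow> bool" where
  "local_ring R \<longleftrightarrow> ring R \<and> (\<exists>!M. maximal_left_ideal M R)"

definition mult_prob :: "('a, 'm) ring_scheme \<Rightarrow> 'a \<Rightarrow> real" where
  "mult_prob R x =
     real (card {(a, b). a \<in> carrier R \<and> b \<in> carrier R \<and> a \<otimes>\<^bsub>R\<^esub> b = x}) / real (order R) ^ 2"

end

theory Submission
  imports Defs
begin

text \<open>
  In a finite local ring the radical \<open>J\<close> is the set of nonunits, so that \<open>\<bar>R\<bar> = q \<bar>J\<bar>\<close>.  A unit has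
  exactly one factorization for each choice of a unit as left factor.  A nonunit \<open>x\<close> has one
  factorization for each unit as left factor, one for each unit as right factor, and those inside
  \<open>J \<times> J\<close>.  So everything rests on bounding the number \<open>M(x)\<close> of pairs in \<open>J \<times> J\<close> with product \<open>x\<close>.

  Let \<open>L\<close> be the left annihilator of \<open>J\<close> in \<open>J\<close>.  If \<open>y \<noteq> 0\<close>, then the right annihilator of \<open>y\<close> lies
  in \<open>J\<close>, so the right ideal \<open>y R\<close> has at least \<open>q\<close> elements.  If \<open>J \<noteq> 0\<close>, then among
  the nonzero \<open>y \<in> J\<close> one with \<open>\<bar>y R\<bar>\<close> least satisfies \<open>y J = 0\<close>, because \<open>y j \<noteq> 0\<close> would give
  \<open>y j R = y R\<close>, whence \<open>y (1 - j r) = 0\<close> for some \<open>r\<close> although \<open>1 - j r\<close> is a unit.  Therefore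
  \<open>y R \<subseteq> L\<close> and \<open>\<bar>L\<bar> \<ge> q\<close>.  Counting the pairs in \<open>L \<times> J\<close> and \<open>J \<times> {0}\<close> bounds \<open>M(0)\<close> from below.
  For \<open>x \<noteq> 0\<close>, a left factor in \<open>L\<close> gives no factorization of \<open>x\<close>, and any other \<open>a \<in> J\<close> gives at
  most \<open>\<bar>J\<bar> / q\<close> of them, because the nonempty fibres of \<open>b \<mapsto> a b\<close> on \<open>J\<close> have equal size and
  there are \<open>\<bar>a J\<bar> \<ge> q\<close> of them; this bounds \<open>M(x)\<close> from above.  In the other two directions the
  trivial bounds \<open>0 \<le> M(x)\<close> and \<open>M(0) \<le> \<bar>J\<bar>\<^sup>2\<close> suffice.  The factorizations with a unit factor
  already outnumber those of a unit, so the count separates units from nonunits.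
\<close>

section \<open>Nonunits in a local ring\<close>

lemma (in monoid) Units_if_finite_one_sided_inverse:
  assumes fin: "finite (carrier G)" and y: "y \<in> carrier G" and x: "x \<in> carrier G"
    and yx: "y \<otimes> x = \<one>"
  shows "x \<in> Units G" "y \<in> Units G"
proof -
  have "inj_on (\<lambda>b. x \<otimes> b) (carrier G)"
  proof (rule inj_onI)
    fix b c assume b: "b \<in> carrier G" and c: "c \<in> carrier G" and eq: "x \<otimes> b = x \<otimes> c"
    have "y \<otimes> (x \<otimes> b) = y \<otimes> (x \<otimes> c)" using eq by simp
    then show "b = c" using b c x y yx by (simp add: m_assoc[symmetric])
  qed
  then have "(\<lambda>b. x \<otimes> b) ` carrier G = carrier G"
    using fin x by (intro endo_inj_surj) auto
  then obtain b where b: "b \<in> carrier G" "x \<otimes> b = \<one>"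
    by (metis imageE one_closed)
  have "y = b" using inv_unique[OF yx b(2) x y b(1)] .
  then have "x \<otimes> y = \<one>" using b by simp
  then show "x \<in> Units G" "y \<in> Units G"
    using x y yx by (auto simp: Units_def)
qed

lemma (in ring) left_ideal_principal:
  assumes x: "x \<in> carrier R"
  shows "left_ideal ((\<lambda>r. r \<otimes> x) ` carrier R) R"
proof -
  have "subgroup ((\<lambda>r. r \<otimes> x) ` carrier R) (add_monoid R)"
  proof (rule add.subgroupI)
    show "(\<lambda>r. r \<otimes> x) ` carrier R \<subseteq> carrier R" using x by auto
    show "(\<lambda>r. r \<otimes> x) ` carrier R \<noteq> {}" by auto
  next
    fix a assume "a \<in> (\<lambda>r. r \<otimes> x) ` carrier R"
    then obtain r where "r \<in> carrier R" "a = r \<otimes> x" by auto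
    then have "\<ominus> a = (\<ominus> r) \<otimes> x" "\<ominus> r \<in> carrier R" using x by (auto simp: l_minus)
    then show "\<ominus> a \<in> (\<lambda>r. r \<otimes> x) ` carrier R" by blast
  next
    fix a b assume "a \<in> (\<lambda>r. r \<otimes> x) ` carrier R" "b \<in> (\<lambda>r. r \<otimes> x) ` carrier R"
    then obtain r s where "r \<in> carrier R" "a = r \<otimes> x" "s \<in> carrier R" "b = s \<otimes> x" by auto
    then have "a \<oplus> b = (r \<oplus> s) \<otimes> x" "r \<oplus> s \<in> carrier R" using x by (auto simp: l_distr)
    then show "a \<oplus> b \<in> (\<lambda>r. r \<otimes> x) ` carrier R" by blast
  qed
  moreover have "r \<otimes> a \<in> (\<lambda>r. r \<otimes> x) ` carrier R"
    if "r \<in> carrier R" "a \<in> (\<lambda>r. r \<otimes> x) ` carrier R" for r a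
    using that x by (auto simp: m_assoc[symmetric])
  ultimately show ?thesis
    by (auto simp: left_ideal_def additive_subgroup_def)
qed

lemma left_ideal_subset: "left_ideal I R \<Longrightarrow> I \<subseteq> carrier R"
  by (simp add: left_ideal_def additive_subgroup.a_subset)

lemma exists_maximal_left_ideal:
  assumes fin: "finite (carrier R)" and I: "left_ideal I R" and ne: "I \<noteq> carrier R"
  obtains M where "maximal_left_ideal M R" "I \<subseteq> M"
proof -
  let ?S = "{K. left_ideal K R \<and> K \<noteq> carrier R \<and> I \<subseteq> K}"
  have "finite ?S"
    by (rule finite_subset[where B = "Pow (carrier R)"]) (use fin in \<open>auto dest: left_ideal_subset\<close>)
  moreover have "?S \<noteq> {}" using I ne by auto
  ultimately have "\<exists>M\<in>?S. \<forall>K\<in>?S. M \<subseteq> K \<longrightarrow> M = K" by (rule finite_has_maximal)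
  then obtain M where M: "M \<in> ?S" and max: "\<forall>K\<in>?S. M \<subseteq> K \<longrightarrow> M = K"
    by (rule bexE)
  have "K = M \<or> K = carrier R" if K: "left_ideal K R" "M \<subseteq> K" for K
  proof (cases "K = carrier R")
    case False
    then have "K \<in> ?S" using K M by auto
    then show ?thesis using max K(2) by auto
  qed simp
  then have "maximal_left_ideal M R"
    using M by (simp add: maximal_left_ideal_def)
  then show ?thesis using that M by simp
qed

text \<open>
  An element outside the unique maximal left ideal generates the unit left ideal, hence has a left
  inverse, and finiteness makes this inverse two-sided.
\<close>

lemma finite_local_ring_nonunits:
  fixes R (structure)
  assumes loc: "local_ring R" and fin: "finite (carrier R)"
  shows "jacobson_radical R = carrier R - Units R" "ideal (carrier R - Units R) R"
proof -
  interpret ring R using loc by (simp add: local_ring_def)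
  obtain M where M: "maximal_left_ideal M R" and uniq: "\<And>N. maximal_left_ideal N R \<Longrightarrow> N = M"
    using loc by (auto simp: local_ring_def)
  have lM: "left_ideal M R" and MR: "M \<noteq> carrier R"
    using M by (auto simp: maximal_left_ideal_def)
  have MsubR: "M \<subseteq> carrier R" by (rule left_ideal_subset[OF lM])
  have unit: "x \<in> Units R" if x: "x \<in> carrier R" "x \<notin> M" for x
  proof -
    have lx: "left_ideal ((\<lambda>r. r \<otimes> x) ` carrier R) R" by (rule left_ideal_principal[OF x(1)])
    have "x = \<one> \<otimes> x" using x by simp
    then have "x \<in> (\<lambda>r. r \<otimes> x) ` carrier R" by blast
    then have "(\<lambda>r. r \<otimes> x) ` carrier R = carrier R"
      using exists_maximal_left_ideal[OF fin lx] uniq x(2) by blast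
    then obtain y where "y \<in> carrier R" "y \<otimes> x = \<one>" by (metis imageE one_closed)
    then show ?thesis using Units_if_finite_one_sided_inverse(1)[OF fin _ x(1)] by blast
  qed
  have nonunit: "x \<notin> Units R" if x: "x \<in> M" for x
  proof
    assume u: "x \<in> Units R"
    have "r \<in> M" if r: "r \<in> carrier R" for r
    proof -
      have "(r \<otimes> inv x) \<otimes> x \<in> M"
        using lM x r u by (auto simp: left_ideal_def)
      then show ?thesis using r u by (simp add: m_assoc Units_closed)
    qed
    with MsubR MR show False by blast
  qed
  have Meq: "M = carrier R - Units R" using unit nonunit MsubR by blast
  have "{N. maximal_left_ideal N R} = {M}" using M uniq by blast
  then have "jacobson_radical R = M" using MsubR by (simp add: jacobson_radical_def Int_absorb1)
  then show "jacobson_radical R = carrier R - Units R" using Meq by simp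
  have "ideal M R"
  proof (rule idealI)
    show "ring R" by (rule ring_axioms)
    show "subgroup M (add_monoid R)"
      using lM by (simp add: left_ideal_def additive_subgroup.a_subgroup)
    show "r \<otimes> a \<in> M" if "a \<in> M" "r \<in> carrier R" for a r
      using lM that by (simp add: left_ideal_def)
  next
    fix a r assume a: "a \<in> M" and r: "r \<in> carrier R"
    have aR: "a \<in> carrier R" using a MsubR by auto
    show "a \<otimes> r \<in> M"
    proof (rule ccontr)
      assume "a \<otimes> r \<notin> M"
      then have u: "a \<otimes> r \<in> Units R" using unit aR r by simp
      then have "a \<otimes> (r \<otimes> inv (a \<otimes> r)) = \<one>"
        using aR r by (simp add: m_assoc[symmetric])
      moreover have "r \<otimes> inv (a \<otimes> r) \<in> carrier R" using r u by simp
      ultimately have "a \<in> Units R"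
        by (intro Units_if_finite_one_sided_inverse(2)[OF fin aR])
      with nonunit a show False by blast
    qed
  qed
  then show "ideal (carrier R - Units R) R" using Meq by simp
qed

section \<open>Fibres of left multiplication\<close>

lemma (in ring) card_mult_fibre:
  assumes S: "additive_subgroup S R" and a: "a \<in> carrier R" and c: "c \<in> S"
  shows "card {b \<in> S. a \<otimes> b = a \<otimes> c} = card {b \<in> S. a \<otimes> b = \<zero>}"
proof -
  interpret S: additive_subgroup S R by (rule S)
  have cR: "c \<in> carrier R" using c S.a_subset by auto
  have "bij_betw (\<lambda>b. b \<ominus> c) {b \<in> S. a \<otimes> b = a \<otimes> c} {b \<in> S. a \<otimes> b = \<zero>}"
  proof (rule bij_betw_byWitness[where f' = "\<lambda>b. b \<oplus> c"])
    show "\<forall>b\<in>{b \<in> S. a \<otimes> b = a \<otimes> c}. b \<ominus> c \<oplus> c = b"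
      using cR S.a_subset by (auto simp: minus_eq a_assoc l_neg)
    show "\<forall>b\<in>{b \<in> S. a \<otimes> b = \<zero>}. b \<oplus> c \<ominus> c = b"
      using cR S.a_subset by (auto simp: minus_eq a_assoc r_neg)
    show "(\<lambda>b. b \<ominus> c) ` {b \<in> S. a \<otimes> b = a \<otimes> c} \<subseteq> {b \<in> S. a \<otimes> b = \<zero>}"
    proof clarify
      fix b assume b: "b \<in> S" and eq: "a \<otimes> b = a \<otimes> c"
      have bR: "b \<in> carrier R" using b S.a_subset by auto
      have "a \<otimes> (b \<ominus> c) = \<zero>"
        using a bR cR eq by (simp add: minus_eq r_distr r_minus r_neg)
      moreover have "b \<ominus> c \<in> S"
        using b c by (simp add: minus_eq)
      ultimately show "b \<ominus> c \<in> S \<and> a \<otimes> (b \<ominus> c) = \<zero>" by blast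
    qed
    show "(\<lambda>b. b \<oplus> c) ` {b \<in> S. a \<otimes> b = \<zero>} \<subseteq> {b \<in> S. a \<otimes> b = a \<otimes> c}"
    proof clarify
      fix b assume b: "b \<in> S" and eq: "a \<otimes> b = \<zero>"
      have bR: "b \<in> carrier R" using b S.a_subset by auto
      have "a \<otimes> (b \<oplus> c) = a \<otimes> c" using a bR cR eq by (simp add: r_distr)
      moreover have "b \<oplus> c \<in> S" using b c by simp
      ultimately show "b \<oplus> c \<in> S \<and> a \<otimes> (b \<oplus> c) = a \<otimes> c" by blast
    qed
  qed
  then show ?thesis by (rule bij_betw_same_card)
qed

lemma (in ring) card_mult_image_kernel:
  assumes S: "additive_subgroup S R" and fin: "finite S" and a: "a \<in> carrier R"
  shows "card ((\<lambda>b. a \<otimes> b) ` S) * card {b \<in> S. a \<otimes> b = \<zero>} = card S"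
proof -
  have "card S = card (\<Union>z\<in>(\<lambda>b. a \<otimes> b) ` S. {b \<in> S. a \<otimes> b = z})"
    by (rule arg_cong[where f = card]) auto
  also have "\<dots> = (\<Sum>z\<in>(\<lambda>b. a \<otimes> b) ` S. card {b \<in> S. a \<otimes> b = z})"
    using fin by (intro card_UN_disjoint) auto
  also have "\<dots> = (\<Sum>z\<in>(\<lambda>b. a \<otimes> b) ` S. card {b \<in> S. a \<otimes> b = \<zero>})"
    using card_mult_fibre[OF S a] by (intro sum.cong) auto
  finally show ?thesis by simp
qed

section \<open>Factorizations in a finite local ring\<close>

text \<open>
  A finite local ring, described by its nonunits being an ideal; \<open>q\<close> is the index of this ideal,
  that is, the size of the residue ring.  The zero ring is excluded, since its only element is a
  unit and the empty set is not an ideal.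
\<close>

locale finite_local_ring = ring R for R (structure) +
  fixes J :: "'a set" and q :: nat
  assumes finite_carrier: "finite (carrier R)"
    and J_def: "J = carrier R - Units R"
    and J_ideal: "ideal J R"
    and order_eq: "order R = q * card J"
begin

lemma J_subset: "x \<in> J \<Longrightarrow> x \<in> carrier R"
  by (simp add: J_def)

lemma finite_J: "finite J"
  using finite_carrier by (simp add: J_def)

lemma finite_Units: "finite (Units R)"
  by (rule finite_ring_finite_units[OF finite_carrier])

lemma J_additive: "additive_subgroup J R"
  using J_ideal by (simp add: ideal.axioms(1))

lemma zero_in_J: "\<zero> \<in> J"
  by (rule additive_subgroup.zero_closed[OF J_additive])

lemma J_mult_right: "a \<in> J \<Longrightarrow> r \<in> carrier R \<Longrightarrow> a \<otimes> r \<in> J"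
  by (rule ideal.I_r_closed[OF J_ideal])

lemma J_mult_left: "a \<in> J \<Longrightarrow> r \<in> carrier R \<Longrightarrow> r \<otimes> a \<in> J"
  by (rule ideal.I_l_closed[OF J_ideal])

lemma card_J_pos: "card J > 0"
  using finite_J zero_in_J card_gt_0_iff by blast

lemma card_Units: "card (Units R) + card J = q * card J"
proof -
  have "card (Units R \<union> J) = card (Units R) + card J"
    using finite_Units finite_J by (intro card_Un_disjoint) (auto simp: J_def)
  moreover have "Units R \<union> J = carrier R" by (auto simp: J_def)
  ultimately show ?thesis using order_eq by (simp add: order_def)
qed

lemma one_minus_J_unit:
  assumes j: "j \<in> J"
  shows "\<one> \<ominus> j \<in> Units R"
proof (rule ccontr)
  have jR: "j \<in> carrier R" using j by (rule J_subset)
  assume "\<one> \<ominus> j \<notin> Units R"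
  then have "\<one> \<ominus> j \<in> J" using jR by (simp add: J_def)
  then have "(\<one> \<ominus> j) \<oplus> j \<in> J"
    using j additive_subgroup.a_closed[OF J_additive] by blast
  then have "\<one> \<in> J" using jR by (simp add: minus_eq a_assoc l_neg)
  then show False by (simp add: J_def)
qed

lemma zero_if_mult_unit_zero:
  assumes "y \<in> carrier R" "u \<in> Units R" "y \<otimes> u = \<zero>"
  shows "y = \<zero>"
proof -
  have "y = (y \<otimes> u) \<otimes> inv u" using assms(1,2) by (simp add: m_assoc Units_closed)
  also have "\<dots> = \<zero>" unfolding assms(3) using assms(2) by simp
  finally show ?thesis .
qed

text \<open>
  Since \<open>\<bar>J\<bar>\<close> bounds the right annihilator of \<open>y\<close>, the map \<open>r \<mapsto> y r\<close> takes at least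
  \<open>\<bar>R\<bar> / \<bar>J\<bar> = q\<close> values.
\<close>

lemma card_principal_ge:
  assumes y: "y \<in> carrier R" and ne: "y \<noteq> \<zero>"
  shows "q \<le> card ((\<lambda>r. y \<otimes> r) ` carrier R)"
proof -
  have "{r \<in> carrier R. y \<otimes> r = \<zero>} \<subseteq> J"
    using zero_if_mult_unit_zero[OF y] ne by (auto simp: J_def)
  then have "card ((\<lambda>r. y \<otimes> r) ` carrier R) * card {r \<in> carrier R. y \<otimes> r = \<zero>}
      \<le> card ((\<lambda>r. y \<otimes> r) ` carrier R) * card J"
    by (intro mult_le_mono2 card_mono finite_J)
  moreover have "additive_subgroup (carrier R) R"
    by (rule ideal.axioms(1)[OF oneideal])
  then have "card ((\<lambda>r. y \<otimes> r) ` carrier R) * card {r \<in> carrier R. y \<otimes> r = \<zero>} = q * card J"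
    using card_mult_image_kernel[OF _ finite_carrier y] order_eq by (simp add: order_def)
  ultimately have "q * card J \<le> card ((\<lambda>r. y \<otimes> r) ` carrier R) * card J"
    by simp
  then show ?thesis using card_J_pos by simp
qed

text \<open>A nonzero element of \<open>J\<close> that generates a right ideal of least size annihilates \<open>J\<close>.\<close>

lemma exists_left_annihilator_J:
  assumes nontriv: "J \<noteq> {\<zero>}"
  obtains y where "y \<in> J" "y \<noteq> \<zero>" "\<And>j. j \<in> J \<Longrightarrow> y \<otimes> j = \<zero>"
proof -
  let ?f = "\<lambda>y. card ((\<lambda>r. y \<otimes> r) ` carrier R)"
  have "\<exists>y. y \<in> J - {\<zero>}" using nontriv zero_in_J by blast
  then obtain y where y: "y \<in> J - {\<zero>}" and min: "\<And>z. z \<in> J - {\<zero>} \<Longrightarrow> ?f y \<le> ?f z"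
    using ex_has_least_nat[of "\<lambda>y. y \<in> J - {\<zero>}" _ ?f] by blast
  have yR: "y \<in> carrier R" using y J_subset by auto
  have "y \<otimes> j = \<zero>" if j: "j \<in> J" for j
  proof (rule ccontr)
    assume ne: "y \<otimes> j \<noteq> \<zero>"
    have jR: "j \<in> carrier R" using j by (rule J_subset)
    have "?f y \<le> ?f (y \<otimes> j)" using min[of "y \<otimes> j"] y ne J_mult_right jR by blast
    moreover have "(\<lambda>r. (y \<otimes> j) \<otimes> r) ` carrier R \<subseteq> (\<lambda>r. y \<otimes> r) ` carrier R"
      using yR jR by (auto simp: m_assoc)
    ultimately have "(\<lambda>r. (y \<otimes> j) \<otimes> r) ` carrier R = (\<lambda>r. y \<otimes> r) ` carrier R"
      using finite_carrier by (intro card_seteq) auto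
    moreover have "y \<in> (\<lambda>r. y \<otimes> r) ` carrier R" using yR by (metis image_eqI one_closed r_one)
    ultimately obtain r where r: "r \<in> carrier R" "y = (y \<otimes> j) \<otimes> r" by blast
    have jr: "j \<otimes> r \<in> J" using J_mult_right j r by blast
    have "y \<otimes> (\<one> \<ominus> j \<otimes> r) = y \<ominus> (y \<otimes> j) \<otimes> r"
      using yR jR r(1) by (simp add: minus_eq r_distr r_minus m_assoc)
    also have "\<dots> = \<zero>" using r yR by (simp add: minus_eq r_neg)
    finally have "y = \<zero>"
      using zero_if_mult_unit_zero[OF yR one_minus_J_unit[OF jr]] by blast
    then show False using y by blast
  qed
  then show ?thesis using that y by blast
qed

lemma card_left_annihilator_J_ge:
  assumes "J \<noteq> {\<zero>}"
  shows "q \<le> card {a \<in> J. \<forall>j\<in>J. a \<otimes> j = \<zero>}"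
proof -
  obtain y where y: "y \<in> J" "y \<noteq> \<zero>" and ann: "\<And>j. j \<in> J \<Longrightarrow> y \<otimes> j = \<zero>"
    using exists_left_annihilator_J[OF assms] by blast
  have yR: "y \<in> carrier R" using y J_subset by auto
  have "(\<lambda>r. y \<otimes> r) ` carrier R \<subseteq> {a \<in> J. \<forall>j\<in>J. a \<otimes> j = \<zero>}"
    using y yR ann J_mult_right J_mult_left J_subset by (auto simp: m_assoc)
  then have "card ((\<lambda>r. y \<otimes> r) ` carrier R) \<le> card {a \<in> J. \<forall>j\<in>J. a \<otimes> j = \<zero>}"
    using finite_J by (intro card_mono) auto
  then show ?thesis using card_principal_ge[OF yR y(2)] by simp
qed

lemma card_fibre_in_J_le:
  assumes a: "a \<in> J" and k: "k \<in> J" and ne: "a \<otimes> k \<noteq> \<zero>"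
  shows "q * card {b \<in> J. a \<otimes> b = x} \<le> card J"
proof (cases "\<exists>c\<in>J. a \<otimes> c = x")
  case True
  then obtain c where c: "c \<in> J" "a \<otimes> c = x" by blast
  have aR: "a \<in> carrier R" and kR: "k \<in> carrier R" using a k J_subset by auto
  have "(\<lambda>r. (a \<otimes> k) \<otimes> r) ` carrier R \<subseteq> (\<lambda>b. a \<otimes> b) ` J"
    using aR kR k J_mult_right by (auto simp: m_assoc)
  then have "card ((\<lambda>r. (a \<otimes> k) \<otimes> r) ` carrier R) \<le> card ((\<lambda>b. a \<otimes> b) ` J)"
    using finite_J by (intro card_mono) auto
  moreover have "q \<le> card ((\<lambda>r. (a \<otimes> k) \<otimes> r) ` carrier R)"
    using card_principal_ge aR kR ne by simp
  ultimately have "q \<le> card ((\<lambda>b. a \<otimes> b) ` J)" by simp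
  then have "q * card {b \<in> J. a \<otimes> b = \<zero>}
      \<le> card ((\<lambda>b. a \<otimes> b) ` J) * card {b \<in> J. a \<otimes> b = \<zero>}"
    by (rule mult_le_mono1)
  also have "card ((\<lambda>b. a \<otimes> b) ` J) * card {b \<in> J. a \<otimes> b = \<zero>} = card J"
    by (rule card_mult_image_kernel[OF J_additive finite_J aR])
  finally show ?thesis
    using card_mult_fibre[OF J_additive aR c(1)] c(2) by simp
next
  case False
  then have "{b \<in> J. a \<otimes> b = x} = {}" by blast
  then show ?thesis by (simp only: card.empty mult_0_right le0)
qed

text \<open>The number of factorizations of \<open>x\<close> into two nonunits.\<close>

definition radical_factorizations :: "'a \<Rightarrow> nat" where
  "radical_factorizations x = card {(a, b). a \<in> J \<and> b \<in> J \<and> a \<otimes> b = x}"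

lemma radical_factorizations_eq_sum:
  "radical_factorizations x = (\<Sum>a\<in>J. card {b \<in> J. a \<otimes> b = x})"
proof -
  have "{(a, b). a \<in> J \<and> b \<in> J \<and> a \<otimes> b = x} = Sigma J (\<lambda>a. {b \<in> J. a \<otimes> b = x})" by auto
  then show ?thesis using finite_J by (simp add: radical_factorizations_def)
qed

lemma radical_factorizations_le_square: "radical_factorizations x \<le> card J * card J"
proof -
  have "(\<Sum>a\<in>J. card {b \<in> J. a \<otimes> b = x}) \<le> (\<Sum>a\<in>J. card J)"
    using finite_J by (intro sum_mono card_mono) auto
  then show ?thesis by (simp add: radical_factorizations_eq_sum)
qed

lemma radical_factorizations_nonzero:
  assumes nontriv: "J \<noteq> {\<zero>}" and x: "x \<noteq> \<zero>"
  shows "q * radical_factorizations x \<le> (card J - q) * card J"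
proof -
  let ?L = "{a \<in> J. \<forall>j\<in>J. a \<otimes> j = \<zero>}"
  have "card {b \<in> J. a \<otimes> b = x} = 0" if "a \<in> ?L" for a
  proof -
    have "{b \<in> J. a \<otimes> b = x} = {}" using that x by blast
    then show ?thesis by (simp only: card.empty)
  qed
  then have "radical_factorizations x = (\<Sum>a\<in>J - ?L. card {b \<in> J. a \<otimes> b = x})"
    unfolding radical_factorizations_eq_sum using finite_J
    by (intro sum.mono_neutral_right) auto
  then have "q * radical_factorizations x = (\<Sum>a\<in>J - ?L. q * card {b \<in> J. a \<otimes> b = x})"
    by (simp add: sum_distrib_left)
  also have "\<dots> \<le> (\<Sum>a\<in>J - ?L. card J)"
    using card_fibre_in_J_le by (intro sum_mono) blast
  also have "\<dots> = (card J - card ?L) * card J"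
    using finite_J by (simp add: card_Diff_subset)
  also have "\<dots> \<le> (card J - q) * card J"
    using card_left_annihilator_J_ge[OF nontriv] by (intro mult_le_mono1 diff_le_mono2)
  finally show ?thesis .
qed

lemma radical_factorizations_zero:
  assumes nontriv: "J \<noteq> {\<zero>}"
  shows "q * card J + card J \<le> radical_factorizations \<zero> + q"
proof -
  let ?L = "{a \<in> J. \<forall>j\<in>J. a \<otimes> j = \<zero>}"
  have finL: "finite ?L" using finite_J by simp
  have inL: "card {b \<in> J. a \<otimes> b = \<zero>} = card J" if "a \<in> ?L" for a
    using that by (intro arg_cong[where f = card]) blast
  (* Every element of J is annihilated at least by the right factor 0. *)
  have notinL: "1 \<le> card {b \<in> J. a \<otimes> b = \<zero>}" if "a \<in> J - ?L" for a
  proof -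
    have "\<zero> \<in> {b \<in> J. a \<otimes> b = \<zero>}" using that zero_in_J J_subset by auto
    then have "card {b \<in> J. a \<otimes> b = \<zero>} > 0" using finite_J by (auto simp: card_gt_0_iff)
    then show ?thesis by simp
  qed
  have "radical_factorizations \<zero>
      = (\<Sum>a\<in>J - ?L. card {b \<in> J. a \<otimes> b = \<zero>}) + (\<Sum>a\<in>?L. card {b \<in> J. a \<otimes> b = \<zero>})"
    unfolding radical_factorizations_eq_sum using finite_J by (intro sum.subset_diff) auto
  moreover have "(\<Sum>a\<in>?L. card {b \<in> J. a \<otimes> b = \<zero>}) = card ?L * card J"
    using inL by simp
  moreover have "card (J - ?L) \<le> (\<Sum>a\<in>J - ?L. card {b \<in> J. a \<otimes> b = \<zero>})"
    using sum_mono[of "J - ?L" "\<lambda>_. 1::nat", OF notinL] by simp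
  moreover have "card (J - ?L) + card ?L = card J"
    using finite_J card_mono[OF finite_J, of ?L] by (simp add: card_Diff_subset)
  ultimately have *: "card ?L * card J + card J \<le> radical_factorizations \<zero> + card ?L"
    by linarith
  (* The estimate is monotone in the size of L, which may thus be replaced by its lower bound q. *)
  obtain d where d: "card ?L = q + d"
    using card_left_annihilator_J_ge[OF nontriv] le_Suc_ex by blast
  have "d \<le> d * card J" using card_J_pos by simp
  moreover have "q * card J + d * card J + card J \<le> radical_factorizations \<zero> + (q + d)"
    using * unfolding d by (simp only: add_mult_distrib)
  ultimately show ?thesis by linarith
qed

lemma card_unit_left_factor:
  assumes x: "x \<in> carrier R"
  shows "card {(a, b). a \<in> Units R \<and> b \<in> carrier R \<and> a \<otimes> b = x} = card (Units R)"
proof -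
  have "{(a, b). a \<in> Units R \<and> b \<in> carrier R \<and> a \<otimes> b = x} = (\<lambda>a. (a, inv a \<otimes> x)) ` Units R"
    using x by (auto simp: image_iff m_assoc[symmetric] Units_closed)
  moreover have "inj_on (\<lambda>a. (a, inv a \<otimes> x)) (Units R)" by (auto intro: inj_onI)
  ultimately show ?thesis by (simp add: card_image)
qed

lemma card_unit_right_factor:
  assumes x: "x \<in> carrier R"
  shows "card {(a, b). a \<in> carrier R \<and> b \<in> Units R \<and> a \<otimes> b = x} = card (Units R)"
proof -
  have "{(a, b). a \<in> carrier R \<and> b \<in> Units R \<and> a \<otimes> b = x} = (\<lambda>b. (x \<otimes> inv b, b)) ` Units R"
    using x by (auto simp: image_iff m_assoc Units_closed)
  moreover have "inj_on (\<lambda>b. (x \<otimes> inv b, b)) (Units R)" by (auto intro: inj_onI)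
  ultimately show ?thesis by (simp add: card_image)
qed

lemma card_factorizations_unit:
  assumes x: "x \<in> Units R"
  shows "card {(a, b). a \<in> carrier R \<and> b \<in> carrier R \<and> a \<otimes> b = x} = card (Units R)"
proof -
  have "a \<in> Units R" if a: "a \<in> carrier R" and b: "b \<in> carrier R" and ab: "a \<otimes> b = x" for a b
  proof (rule ccontr)
    assume "a \<notin> Units R"
    then have "a \<otimes> b \<in> J" using a b J_mult_right by (simp add: J_def)
    then show False using ab x by (simp add: J_def)
  qed
  then have "{(a, b). a \<in> carrier R \<and> b \<in> carrier R \<and> a \<otimes> b = x}
      = {(a, b). a \<in> Units R \<and> b \<in> carrier R \<and> a \<otimes> b = x}"
    by (auto simp: Units_closed)
  then show ?thesis using card_unit_left_factor x by (simp add: Units_closed)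
qed

lemma card_factorizations_nonunit:
  assumes x: "x \<in> J"
  shows "card {(a, b). a \<in> carrier R \<and> b \<in> carrier R \<and> a \<otimes> b = x}
    = 2 * card (Units R) + radical_factorizations x"
proof -
  let ?A = "{(a, b). a \<in> Units R \<and> b \<in> carrier R \<and> a \<otimes> b = x}"
  let ?B = "{(a, b). a \<in> carrier R \<and> b \<in> Units R \<and> a \<otimes> b = x}"
  let ?C = "{(a, b). a \<in> J \<and> b \<in> J \<and> a \<otimes> b = x}"
  have xR: "x \<in> carrier R" using x by (rule J_subset)
  have fin: "finite (carrier R \<times> carrier R)" using finite_carrier by simp
  have finA: "finite ?A" and finB: "finite ?B" and finC: "finite ?C"
    by (rule finite_subset[OF _ fin]; auto simp: J_def)+
  have AB: "?A \<inter> ?B = {}" using x by (auto simp: J_def)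
  have ABC: "(?A \<union> ?B) \<inter> ?C = {}" by (auto simp: J_def)
  have "{(a, b). a \<in> carrier R \<and> b \<in> carrier R \<and> a \<otimes> b = x} = (?A \<union> ?B) \<union> ?C"
    by (auto simp: J_def)
  moreover have "card ((?A \<union> ?B) \<union> ?C) = card ?A + card ?B + card ?C"
    using card_Un_disjoint[OF _ finC ABC] card_Un_disjoint[OF finA finB AB] finA finB by simp
  ultimately show ?thesis
    unfolding card_unit_left_factor[OF xR] card_unit_right_factor[OF xR]
      radical_factorizations_def[symmetric] by (simp only: mult_2)
qed

end

section \<open>Bounds on multiplication probabilities\<close>

theorem theorem4p2:
  fixes R :: "('a, 'm) ring_scheme" and F :: "('b, 'k) ring_scheme"
    and q n :: nat
  assumes "local_ring R" and "finite (carrier R)"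
    and "n \<ge> 2" and "order R = q ^ n"
    and "field F" and "finite (carrier F)" and "order F = q"
    and "R Quot (jacobson_radical R) \<simeq> F"
  shows "(\<forall>x\<in>carrier R. x \<in> Units R \<longleftrightarrow> mult_prob R x = (real q - 1) / real q ^ (n + 1))
    \<and> (\<forall>x\<in>jacobson_radical R. x \<noteq> \<zero>\<^bsub>R\<^esub> \<longrightarrow>
          (real q - 1) * (real q ^ (n - 2) + 1) / real q ^ (2 * n - 1) \<le> mult_prob R x
        \<and> mult_prob R x \<le> (real q ^ (n - 1) + real q - 2) / real q ^ (n + 1))
    \<and> (3 * real q ^ (n - 1) - real q ^ (n - 2) - 1) / real q ^ (2 * n - 1) \<le> mult_prob R \<zero>\<^bsub>R\<^esub>
    \<and> mult_prob R \<zero>\<^bsub>R\<^esub> \<le> (real q ^ (n - 1) + 2 * real q - 2) / real q ^ (n + 1)"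
proof -
  define J where "J = jacobson_radical R"
  note nonunits = finite_local_ring_nonunits[OF assms(1,2), folded J_def]
  have ringR: "ring R" using assms(1) by (simp add: local_ring_def)
  interpret ring R by (rule ringR)
  interpret F: field F by (rule assms(5))
  have idealJ: "ideal J R" using nonunits by simp
  have q2: "q \<ge> 2"
  proof -
    have "card {\<zero>\<^bsub>F\<^esub>, \<one>\<^bsub>F\<^esub>} \<le> card (carrier F)"
      using assms(6) by (intro card_mono) auto
    moreover have "card {\<zero>\<^bsub>F\<^esub>, \<one>\<^bsub>F\<^esub>} = 2"
      using F.one_not_zero by (simp add: card_insert_if)
    ultimately show ?thesis using assms(7) by (simp add: order_def)
  qed
  have "card (carrier (R Quot J)) = q"
    using assms(7,8) bij_betw_same_card unfolding is_ring_iso_def ring_iso_def order_def J_def by blast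
  then have "card (a_rcosets\<^bsub>R\<^esub> J) = q" by (simp add: FactRing_def)
  then have ord: "order R = q * card J"
    using a_lagrange[OF assms(2) ideal.axioms(1)[OF idealJ]] by simp
  interpret L: finite_local_ring R J q
    using assms(2) nonunits(1) idealJ ord ringR
    by (intro finite_local_ring.intro finite_local_ring_axioms.intro)
  (* With t = q^(n-2), the orders of R and of J are q^2 t and q t, so that both the powers of q in
     the bounds and the cardinalities become polynomials in q and t. *)
  define t where "t = q ^ (n - 2)"
  obtain m where n: "n = Suc (Suc m)"
    using assms(3) by (metis Suc_le_D Suc_le_mono numeral_2_eq_2)
  have cardJ: "card J = q * t"
    using ord q2 by (simp add: assms(4) t_def n)
  have t1: "t \<ge> 1" using q2 by (simp add: t_def)
  have nontriv: "J \<noteq> {\<zero>\<^bsub>R\<^esub>}"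
  proof
    assume "J = {\<zero>\<^bsub>R\<^esub>}"
    then have "q * t = 1" using cardJ by simp
    then show False using q2 by simp
  qed
  define Q T where "Q = real q" and "T = real t"
  have Q2: "Q \<ge> 2" and T1: "T \<ge> 1" using q2 t1 by (auto simp: Q_def T_def)
  have units: "real (card (Units R)) = Q * Q * T - Q * T"
  proof -
    have "real (card (Units R)) + real (card J) = real (q * card J)"
      using L.card_Units by (metis of_nat_add)
    then show ?thesis by (simp add: cardJ Q_def T_def)
  qed
  define N where "N x = real (card {(a, b). a \<in> carrier R \<and> b \<in> carrier R \<and> a \<otimes>\<^bsub>R\<^esub> b = x})" for x
  have prob: "mult_prob R x = N x / (Q ^ 4 * T ^ 2)" for x
    by (simp add: mult_prob_def N_def ord cardJ Q_def T_def power2_eq_square power4_eq_xxxx mult_ac)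
  have powers: "Q ^ (n - 2) = T" "Q ^ (n - 1) = Q * T" "Q ^ (n + 1) = Q ^ 3 * T"
      "Q ^ (2 * n - 1) = Q ^ 3 * T ^ 2"
    by (simp_all add: n t_def Q_def T_def power2_eq_square power3_eq_cube mult_2_right power_add mult_ac)
  have le1: "mult_prob R x \<le> c / (Q ^ 3 * T) \<longleftrightarrow> N x \<le> Q * T * c" for x c
    unfolding prob using Q2 T1 by (simp add: field_simps power2_eq_square power3_eq_cube power4_eq_xxxx)
  have le2: "c / (Q ^ 3 * T ^ 2) \<le> mult_prob R x \<longleftrightarrow> Q * c \<le> N x" for x c
    unfolding prob using Q2 T1 by (simp add: field_simps power2_eq_square power3_eq_cube power4_eq_xxxx)
  have eq1: "mult_prob R x = c / (Q ^ 3 * T) \<longleftrightarrow> N x = Q * T * c" for x c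
    unfolding prob using Q2 T1 by (simp add: field_simps power2_eq_square power3_eq_cube power4_eq_xxxx)
  define M where "M x = real (L.radical_factorizations x)" for x
  have NJ: "N x = 2 * (Q * Q * T - Q * T) + M x" if "x \<in> J" for x
    using L.card_factorizations_nonunit[OF that] units by (simp add: N_def M_def)
  have upos: "Q * T * (Q - 1) > 0" using Q2 T1 by simp
  have M0: "M x \<ge> 0" for x by (simp add: M_def)
  have part1: "x \<in> Units R \<longleftrightarrow> N x = Q * T * (Q - 1)" if x: "x \<in> carrier R" for x
  proof
    assume "x \<in> Units R"
    then show "N x = Q * T * (Q - 1)"
      using L.card_factorizations_unit[of x] units by (simp add: N_def algebra_simps)
  next
    assume eq: "N x = Q * T * (Q - 1)"
    show "x \<in> Units R"
    proof (rule ccontr)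
      assume "x \<notin> Units R"
      then have "x \<in> J" using x L.J_def by blast
      then have "N x = 2 * (Q * T * (Q - 1)) + M x" using NJ by (simp add: algebra_simps)
      then show False using eq upos M0[of x] by linarith
    qed
  qed
  have part2l: "Q * ((Q - 1) * (T + 1)) \<le> N x" if x: "x \<in> J" for x
  proof -
    have "Q * (Q - 1) * 1 \<le> Q * (Q - 1) * T" using Q2 T1 by (intro mult_left_mono) auto
    then show ?thesis using NJ[OF x] M0[of x] by (simp add: algebra_simps)
  qed
  have part2u: "N x \<le> Q * T * (Q * T + Q - 2)" if x: "x \<in> J" "x \<noteq> \<zero>\<^bsub>R\<^esub>" for x
  proof -
    have "q * L.radical_factorizations x \<le> q * ((q * t - q) * t)"
      using L.radical_factorizations_nonzero[OF nontriv x(2)] by (simp add: cardJ mult_ac)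
    then have "L.radical_factorizations x \<le> (q * t - q) * t" using q2 by simp
    then have "M x \<le> real ((q * t - q) * t)" unfolding M_def by (rule of_nat_mono)
    also have "\<dots> = (Q * T - Q) * T" using t1 by (simp add: Q_def T_def of_nat_diff)
    finally have "M x \<le> (Q * T - Q) * T" .
    (* The claimed bound exceeds the one obtained from the estimate of M by exactly this product. *)
    moreover have "0 \<le> Q * T * ((Q - 1) * (T - 1))"
      using Q2 T1 by (intro mult_nonneg_nonneg) auto
    ultimately show ?thesis using NJ[OF x(1)] by (simp add: algebra_simps)
  qed
  have part3l: "Q * (3 * (Q * T) - T - 1) \<le> N \<zero>\<^bsub>R\<^esub>"
  proof -
    have "real (q * card J + card J) \<le> real (L.radical_factorizations \<zero>\<^bsub>R\<^esub> + q)"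
      using L.radical_factorizations_zero[OF nontriv] by (rule of_nat_mono)
    then have "Q * (Q * T) + Q * T \<le> M \<zero>\<^bsub>R\<^esub> + Q"
      by (simp add: cardJ Q_def T_def M_def)
    then show ?thesis using NJ[OF L.zero_in_J] by (simp add: algebra_simps)
  qed
  have part3u: "N \<zero>\<^bsub>R\<^esub> \<le> Q * T * (Q * T + 2 * Q - 2)"
  proof -
    have "real (L.radical_factorizations \<zero>\<^bsub>R\<^esub>) \<le> real (card J * card J)"
      using L.radical_factorizations_le_square by (rule of_nat_mono)
    then have "M \<zero>\<^bsub>R\<^esub> \<le> (Q * T) * (Q * T)" by (simp add: cardJ Q_def T_def M_def)
    then show ?thesis using NJ[OF L.zero_in_J] by (simp add: algebra_simps)
  qed
  show ?thesis
    unfolding J_def[symmetric] powers Q_def[symmetric] le1 le2 eq1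
    by (intro conjI ballI impI part1 part2l part2u part3l part3u)
qed

end
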